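(* Let $f$ be a point-map and let $\mathcal P_0$ be the Palm distribution of a stationary point process on $\mathbb R^d$ with non-degenerate intensity. For $n\ge1$ let $$\widetilde{\mathcal P}_0^{f,n}:=\frac1n\sum_{i=0}^{n-1}\mathcal P_0^{f,i},\qquad \mathcal P_0^{f,i}:=(\theta_f^i)_*\mathcal P_0 .$$ Assume there exists a subsequence $(\widetilde{\mathcal P}_0^{f,n_i})_{i=1}^\infty$ which converges in $\mathbf M^1(\mathbf N^0)$ to a probability measure $\widetilde{\mathcal P}_0^f$. If the map $(\theta_f)_*:\mathbf M^1(\mathbf N^0)\to\mathbf M^1(\mathbf N^0)$ is continuous at $\widetilde{\mathcal P}_0^f$, then $\widetilde{\mathcal P}_0^f$ solves Mecke's invariant measure equation, i.e. $(\theta_f)_*\widetilde{\mathcal P}_0^f=\widetilde{\mathcal P}_0^f$.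
   Context: $\mathbf N$ is the space of locally finite counting measures on $\mathbb R^d$ (not necessarily simple; identified with multisets), with the vague topology and its Borel $\sigma$-field. $\overline\phi$ is the support of $\phi$; $x\in\phi$ means $\phi(\{x\})>0$. $\mathbf N^0=\{\phi\in\mathbf N:0\in\phi\}$. For $t\in\mathbb R^d$, $\theta_t\phi(B)=\phi(B+t)$ (translation by $-t$). $\mathbf M^1(\mathbf N^0)$ is the set of probability measures on $\mathbf N^0$ with the topology of weak convergence. Point-map: a measurable $f:\mathbf N^0\to\mathbb R^d$ with $f(\phi)=f(\overline\phi)\in\overline\phi$ for all $\phi$. For $\phi\in\mathbf N^0$, $\theta_f(\phi)=\theta_{f(\phi)}\phi\in\mathbf N^0$, with $n$-th iterate $\theta_f^n$ ($\theta_f^0$ the identity). Stationary point process: $(\theta_t)_{t\in\mathbb R^d}$ is a measurable flow on a probability space $(\Omega,\mathcal F,\mathbb P)$ leaving $\mathbb P$ invariant, and $\Phi:\Omega\to\mathbf N$ is measurable with $\Phi\circ\theta_t=\theta_t\circ\Phi$. Its intensity $\lambda$ is the mean number of points (with multiplicity) in the unit cube; it is non-degenerate if $0<\lambda<\infty$. The Palm probability is $\mathbb P_\Phi[A]=\frac1{\lambda|B|}\int_\Omega\int_B\mathbf 1\{\theta_t\omega\in A\}\,\Phi(\omega,dt)\,\mathbb P[d\omega]$ for any Borel $B$ with Lebesgue measure $0<|B|<\infty$. $\mathcal P_0=\Phi_*\mathbb P_\Phi$ is the Palm distribution, a probability on $\mathbf N^0$. Here $h_*\mu(A)=\mu(h^{-1}A)$.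 *)

theory Defs
  imports "HOL-Probability.Probability"
begin

section \<open>Borel structure, initial topologies and weak convergence\<close>

definition borel_of :: "'a topology \<Rightarrow> 'a measure" where
  "borel_of X = sigma (topspace X) {U. openin X U}"

text \<open>The coarsest topology on \<open>S\<close> that makes all functions in \<open>F\<close> continuous. Its
  carrier is \<open>S\<close> only for nonempty \<open>F\<close>.\<close>

definition initial_topology :: "'a set \<Rightarrow> ('a \<Rightarrow> real) set \<Rightarrow> 'a topology" where
  "initial_topology S F = topology_generated_by {S \<inter> h -` U | h U. h \<in> F \<and> open U}"

definition weak_topology :: "'a topology \<Rightarrow> 'a measure topology" where
  "weak_topology X = initial_topology
     {\<mu>. prob_space \<mu> \<and> sets \<mu> = sets (borel_of X)}
     {\<lambda>\<mu>. \<integral>x. h x \<partial>\<mu> | h. continuous_map X euclideanreal h \<and> bounded (h ` topspace X)}"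

section \<open>Counting measures\<close>

definition counting_measures :: "'a::euclidean_space measure set" where
  "counting_measures = {\<phi>. sets \<phi> = sets borel \<and>
     (\<forall>B\<in>sets borel. bounded B \<longrightarrow> (\<exists>k::nat. emeasure \<phi> B = of_nat k))}"

definition vague_topology :: "'a::euclidean_space measure topology" where
  "vague_topology = initial_topology counting_measures
     {\<lambda>\<phi>. \<integral>x. g x \<partial>\<phi> | g. continuous_on UNIV g \<and> compact (closure {x. g x \<noteq> 0})}"

definition counting_measures0 :: "'a::euclidean_space measure set" where
  "counting_measures0 = {\<phi> \<in> counting_measures. emeasure \<phi> {0} > 0}"

definition vague_topology0 :: "'a::euclidean_space measure topology" where
  "vague_topology0 = subtopology vague_topology counting_measures0"

definition support :: "'a::euclidean_space measure \<Rightarrow> 'a set" where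
  "support \<phi> = {x. \<forall>U. open U \<and> x \<in> U \<longrightarrow> emeasure \<phi> U > 0}"

text \<open>The support regarded as a simple counting measure, \<open>B \<mapsto> card (B \<inter> support \<phi>)\<close>.\<close>

definition support_measure :: "'a::euclidean_space measure \<Rightarrow> 'a measure" where
  "support_measure \<phi> = distr (count_space (support \<phi>)) borel (\<lambda>x. x)"

text \<open>\<open>translate t \<phi> B = \<phi> (B + t)\<close>, since \<open>B + t\<close> is the preimage of \<open>B\<close> under
  \<open>x \<mapsto> x - t\<close>.\<close>

definition translate :: "'a::euclidean_space \<Rightarrow> 'a measure \<Rightarrow> 'a measure" where
  "translate t \<phi> = distr \<phi> borel (\<lambda>x. x - t)"

section \<open>Point-maps\<close>

definition point_map :: "('a::euclidean_space measure \<Rightarrow> 'a) \<Rightarrow> bool" where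
  "point_map f \<longleftrightarrow> f \<in> borel_of vague_topology0 \<rightarrow>\<^sub>M borel \<and>
     (\<forall>\<phi>\<in>counting_measures0. f \<phi> = f (support_measure \<phi>) \<and> f \<phi> \<in> support \<phi>)"

definition point_shift ::
  "('a::euclidean_space measure \<Rightarrow> 'a) \<Rightarrow> 'a measure \<Rightarrow> 'a measure" where
  "point_shift f \<phi> = translate (f \<phi>) \<phi>"

definition point_shift_push ::
  "('a::euclidean_space measure \<Rightarrow> 'a) \<Rightarrow> 'a measure measure \<Rightarrow> 'a measure measure" where
  "point_shift_push f \<mu> = distr \<mu> (borel_of vague_topology0) (point_shift f)"

definition point_map_prob ::
  "('a::euclidean_space measure \<Rightarrow> 'a) \<Rightarrow> 'a measure measure \<Rightarrow> nat \<Rightarrow> 'a measure measure" where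
  "point_map_prob f \<mu> i = distr \<mu> (borel_of vague_topology0) (point_shift f ^^ i)"

definition point_map_cesaro ::
  "('a::euclidean_space measure \<Rightarrow> 'a) \<Rightarrow> 'a measure measure \<Rightarrow> nat \<Rightarrow> 'a measure measure" where
  "point_map_cesaro f \<mu> n =
     measure_of (topspace vague_topology0) (sets (borel_of vague_topology0))
       (\<lambda>A. (\<Sum>i<n. emeasure (point_map_prob f \<mu> i) A) / of_nat n)"

section \<open>Stationary point processes and Palm distributions\<close>

definition stationary_point_process ::
  "'w measure \<Rightarrow> ('a::euclidean_space \<Rightarrow> 'w \<Rightarrow> 'w) \<Rightarrow> ('w \<Rightarrow> 'a measure) \<Rightarrow> bool" where
  "stationary_point_process M \<theta> \<Phi> \<longleftrightarrow>
     prob_space M \<and>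
     (\<lambda>(t, \<omega>). \<theta> t \<omega>) \<in> borel \<Otimes>\<^sub>M M \<rightarrow>\<^sub>M M \<and>
     (\<forall>\<omega>\<in>space M. \<theta> 0 \<omega> = \<omega>) \<and>
     (\<forall>s t. \<forall>\<omega>\<in>space M. \<theta> s (\<theta> t \<omega>) = \<theta> (s + t) \<omega>) \<and>
     (\<forall>t. distr M M (\<theta> t) = M) \<and>
     \<Phi> \<in> M \<rightarrow>\<^sub>M borel_of vague_topology \<and>
     (\<forall>t. \<forall>\<omega>\<in>space M. \<Phi> (\<theta> t \<omega>) = translate t (\<Phi> \<omega>))"

definition intensity :: "'w measure \<Rightarrow> ('w \<Rightarrow> 'a::euclidean_space measure) \<Rightarrow> ennreal" where
  "intensity M \<Phi> = (\<integral>\<^sup>+\<omega>. emeasure (\<Phi> \<omega>) (cbox 0 One) \<partial>M)"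

text \<open>For a stationary point process the following does not depend on the Borel set \<open>B\<close>, as long
  as \<open>B\<close> has positive and finite Lebesgue measure.\<close>

definition palm_probability ::
  "'w measure \<Rightarrow> ('a::euclidean_space \<Rightarrow> 'w \<Rightarrow> 'w) \<Rightarrow> ('w \<Rightarrow> 'a measure) \<Rightarrow> 'a set \<Rightarrow> 'w measure"
where
  "palm_probability M \<theta> \<Phi> B = measure_of (space M) (sets M)
     (\<lambda>A. (\<integral>\<^sup>+\<omega>. (\<integral>\<^sup>+t. indicator A (\<theta> t \<omega>) * indicator B t \<partial>\<Phi> \<omega>) \<partial>M)
        / (intensity M \<Phi> * emeasure lborel B))"

text \<open>The process \<open>\<Phi>\<close> need only have an atom at the origin almost surely under the Palm
  probability, not everywhere on \<open>\<Omega>\<close>. So its law is first formed on the space of all counting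
  measures and then restricted to those with an atom at the origin, a Borel set of full mass.\<close>

definition palm_distribution ::
  "'w measure \<Rightarrow> ('a::euclidean_space \<Rightarrow> 'w \<Rightarrow> 'w) \<Rightarrow> ('w \<Rightarrow> 'a measure) \<Rightarrow> 'a set \<Rightarrow> 'a measure measure"
where
  "palm_distribution M \<theta> \<Phi> B = restrict_space
     (distr (palm_probability M \<theta> \<Phi> B) (borel_of vague_topology) \<Phi>) counting_measures0"

section \<open>Carriers of the topologies\<close>

lemma topspace_initial_topology: "F \<noteq> {} \<Longrightarrow> topspace (initial_topology S F) = S"
  unfolding initial_topology_def topology_generated_by_topspace by (auto intro!: exI[of _ UNIV])

lemma topspace_vague_topology: "topspace vague_topology = counting_measures"
  unfolding vague_topology_def
  by (rule topspace_initial_topology) (auto intro!: exI[of _ "\<lambda>x. 0"])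

lemma topspace_vague_topology0: "topspace vague_topology0 = counting_measures0"
  by (auto simp: vague_topology0_def topspace_vague_topology counting_measures0_def)

lemma topspace_weak_topology:
  "topspace (weak_topology X) = {\<mu>. prob_space \<mu> \<and> sets \<mu> = sets (borel_of X)}"
  unfolding weak_topology_def
  by (rule topspace_initial_topology) (auto simp: image_constant_conv intro!: exI[of _ "\<lambda>x. 0"])

end

theory Submission
  imports Defs
begin

text \<open>The argument is that of Krylov and Bogolyubov. Write \<open>\<mu>\<^sub>n\<close> for the Cesaro means. The push-forward
  of \<open>\<mu>\<^sub>n\<close> by the point-shift is the same average moved by one step, so for a test function bounded
  by \<open>C\<close> its integrals against \<open>\<mu>\<^sub>n\<close> and against the push-forward of \<open>\<mu>\<^sub>n\<close> differ by at most \<open>2 * C / n\<close>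
  (\<open>integral_point_shift_push_cesaro\<close>). Along the given subsequence \<open>\<mu>\<^sub>n\<close> tends to \<open>P\<close>, and by the
  continuity assumption its push-forward tends to the push-forward of \<open>P\<close>. Hence \<open>P\<close> and its
  push-forward have the same integrals against all bounded continuous functions.

  Two facts about the space of counting measures remain. First, bounded continuous functions must
  determine a probability measure on its Borel sets (\<open>prob_measure_eqI_vague0\<close>). The vague topology
  is defined by uncountably many test functions, and its Borel sets are generated by arbitrary
  unions of basic sets, so some countability is required. It comes from a Stone--Weierstrass
  argument: countably many test functions, the monomials multiplied by cutoffs, already generate the
  topology (\<open>integral_continuous_test_integrals\<close>), so every open set is the preimage of an open set
  of the metrizable space of real sequences (\<open>open_vague_topology\<close>).

  Second, the point-shift must be measurable (\<open>measurable_point_shift\<close>). By the same countability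
  this reduces to the measurability of \<open>\<phi> \<mapsto> \<integral>g (x - f \<phi>) \<phi>(dx)\<close>, which is obtained by approximating
  \<open>f\<close> by simple functions.\<close>

section \<open>Borel sets of an initial topology\<close>

lemma space_borel_of: "space (borel_of X) = topspace X"
  unfolding borel_of_def by (simp add: space_measure_of_conv)

lemma sets_borel_of: "sets (borel_of X) = sigma_sets (topspace X) {U. openin X U}"
  unfolding borel_of_def by (intro sets_measure_of) (auto dest: openin_subset)

lemma measurable_borel_of:
  assumes "g \<in> space M \<rightarrow> topspace X"
    and "\<And>U. openin X U \<Longrightarrow> g -` U \<inter> space M \<in> sets M"
  shows "g \<in> M \<rightarrow>\<^sub>M borel_of X"
  by (rule measurable_sigma_sets[OF sets_borel_of])
    (use assms in \<open>auto dest: openin_subset\<close>)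

lemma borel_measurable_continuous_map:
  assumes "continuous_map X euclideanreal h"
  shows "h \<in> borel_measurable (borel_of X)"
proof (rule borel_measurableI)
  fix S :: "real set" assume "open S"
  then have "openin X {x \<in> topspace X. h x \<in> S}"
    using assms by (auto simp: continuous_map_def)
  moreover have "h -` S \<inter> space (borel_of X) = {x \<in> topspace X. h x \<in> S}"
    by (auto simp: space_borel_of)
  ultimately show "h -` S \<inter> space (borel_of X) \<in> sets (borel_of X)"
    by (auto simp: sets_borel_of)
qed

lemma sets_borel_of_subtopology:
  assumes "S \<subseteq> topspace X"
  shows "sets (borel_of (subtopology X S)) = sets (restrict_space (borel_of X) S)"
proof -
  have "{(\<lambda>x. x) -` A \<inter> S | A. A \<in> {U. openin X U}} = {U. openin (subtopology X S) U}"
    by (auto simp: openin_subtopology)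
  moreover have "topspace (subtopology X S) = S"
    using assms by auto
  ultimately have "vimage_algebra S (\<lambda>x. x) (borel_of X) = borel_of (subtopology X S)"
    unfolding borel_of_def
    using vimage_algebra_sigma[of "{U. openin X U}" "topspace X" "\<lambda>x. x" S] assms
    by (auto dest: openin_subset)
  then show ?thesis
    using restrict_space_eq_vimage_algebra[of S "borel_of X"] assms by (simp add: space_borel_of)
qed

lemma openin_initial_topology:
  assumes "h \<in> F" "open U"
  shows "openin (initial_topology S F) (S \<inter> h -` U)"
  unfolding initial_topology_def by (rule topology_generated_by_Basis) (use assms in auto)

lemma continuous_map_initial_topology:
  assumes "h \<in> F"
  shows "continuous_map (initial_topology S F) euclideanreal h"
proof -
  have "{x \<in> topspace (initial_topology S F). h x \<in> U} = S \<inter> h -` U" for U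
    using topspace_initial_topology[of F S] assms by auto
  then show ?thesis
    using openin_initial_topology[OF assms] by (auto simp: continuous_map_def)
qed

text \<open>If every generating function is continuous with respect to \<open>E\<close>, then the initial topology on \<open>S\<close>
  is coarser than the pullback of the topology of \<open>'b\<close> along \<open>E\<close>. In the application \<open>E\<close> collects
  countably many generating functions, and the pullback inherits the second countability and the
  metric of the space of real sequences.\<close>

lemma open_sets_initial_topology:
  fixes E :: "'a \<Rightarrow> 'b::topological_space"
  assumes "F \<noteq> {}"
    and E: "\<And>h \<phi> e. h \<in> F \<Longrightarrow> \<phi> \<in> S \<Longrightarrow> e > 0 \<Longrightarrow>
      \<exists>V. open V \<and> E \<phi> \<in> V \<and> (\<forall>\<psi>\<in>S. E \<psi> \<in> V \<longrightarrow> \<bar>h \<psi> - h \<phi>\<bar> < e)"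
    and "openin (initial_topology S F) W"
  shows "\<exists>V. open V \<and> W = S \<inter> E -` V"
proof -
  have "generate_topology_on {S \<inter> h -` U | h U. h \<in> F \<and> open U} W"
    using assms(3) unfolding initial_topology_def by (rule openin_topology_generated_by)
  then show ?thesis
  proof induction
    case Empty
    show ?case by (rule exI[of _ "{}"]) auto
  next
    case (Int a b)
    then obtain V V' where "open V" "a = S \<inter> E -` V" "open V'" "b = S \<inter> E -` V'" by blast
    then show ?case by (intro exI[of _ "V \<inter> V'"]) auto
  next
    case (UN K)
    then obtain V where "\<And>k. k \<in> K \<Longrightarrow> open (V k) \<and> k = S \<inter> E -` V k" by metis
    then show ?case by (intro exI[of _ "\<Union>(V ` K)"]) fast
  next
    case (Basis s)
    then obtain h U where h: "h \<in> F" "open U" "s = S \<inter> h -` U" by auto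
    have "\<exists>V. open V \<and> E \<phi> \<in> V \<and> S \<inter> E -` V \<subseteq> s" if \<phi>: "\<phi> \<in> s" for \<phi>
    proof -
      have "h \<phi> \<in> U" "\<phi> \<in> S" using \<phi> h by auto
      then obtain e where "e > 0" "\<And>y. dist y (h \<phi>) < e \<Longrightarrow> y \<in> U"
        using \<open>open U\<close> unfolding open_dist by blast
      then show ?thesis
        using E[OF h(1) \<open>\<phi> \<in> S\<close> \<open>e > 0\<close>] unfolding h(3) dist_real_def by blast
    qed
    then obtain V where V: "\<And>\<phi>. \<phi> \<in> s \<Longrightarrow> open (V \<phi>) \<and> E \<phi> \<in> V \<phi> \<and> S \<inter> E -` V \<phi> \<subseteq> s"
      by metis
    then have "open (\<Union>(V ` s))" "s = S \<inter> E -` \<Union>(V ` s)"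
      using h(3) by auto
    then show ?case by blast
  qed
qed

text \<open>The indicator of an open set \<open>V\<close> of a metric space is the limit of the continuous functions
  \<open>min 1 (n * infdist y (- V))\<close>. Composed with \<open>E\<close> they are bounded continuous functions on \<open>X\<close>,
  so dominated convergence carries the equality of their integrals over to the preimage of \<open>V\<close>.\<close>

lemma emeasure_open_eqI:
  fixes E :: "'a \<Rightarrow> 'b::metric_space" and V :: "'b set"
  assumes X: "\<And>g :: 'b \<Rightarrow> real. continuous_on UNIV g \<Longrightarrow> continuous_map X euclideanreal (\<lambda>x. g (E x))"
    and \<mu>: "prob_space \<mu>" "sets \<mu> = sets (borel_of X)"
    and \<nu>: "prob_space \<nu>" "sets \<nu> = sets (borel_of X)"
    and eq: "\<And>h. continuous_map X euclideanreal h \<Longrightarrow> bounded (h ` topspace X) \<Longrightarrow>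
      (\<integral>x. h x \<partial>\<mu>) = (\<integral>x. h x \<partial>\<nu>)"
    and "open V"
  shows "emeasure \<mu> (topspace X \<inter> E -` V) = emeasure \<nu> (topspace X \<inter> E -` V)"
\<comment> \<open>For \<open>V = UNIV\<close> the approximating functions vanish instead of tending to \<open>1\<close>, because the
   distance to the empty set is \<open>0\<close> by convention.\<close>
proof (cases "V = UNIV")
  case True
  have "space \<mu> = topspace X" "space \<nu> = topspace X"
    using sets_eq_imp_space_eq[OF \<mu>(2)] sets_eq_imp_space_eq[OF \<nu>(2)] by (simp_all add: space_borel_of)
  then show ?thesis
    using True prob_space.emeasure_space_1[OF \<mu>(1)] prob_space.emeasure_space_1[OF \<nu>(1)] by simp
next
  case False
  define g where "g n y = min 1 (real n * infdist y (- V))" for n :: nat and y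
  define h where "h n x = g n (E x)" for n x
  have g: "continuous_on UNIV (g n)" "0 \<le> g n y" "g n y \<le> 1" for n y
    unfolding g_def by (simp_all add: continuous_intros infdist_nonneg)
  have h: "continuous_map X euclideanreal (h n)" for n
    unfolding h_def by (rule X[OF g(1)])
  have bdd: "bounded (h n ` topspace X)" for n
    by (rule boundedI[of _ 1]) (auto simp: h_def g)
  have lim: "(\<lambda>n. h n x) \<longlonglongrightarrow> indicator (E -` V) x" for x
  proof (cases "E x \<in> V")
    case True
    then have "infdist (E x) (- V) > 0"
      using in_closed_iff_infdist_zero[of "- V" "E x"] \<open>open V\<close> False infdist_nonneg[of "E x" "- V"]
      by (auto simp: closed_Compl less_le)
    then obtain N :: nat where N: "1 < real N * infdist (E x) (- V)"
      using reals_Archimedean3 by blast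
    have "h n x = 1" if "n \<ge> N" for n
    proof -
      have "real N * infdist (E x) (- V) \<le> real n * infdist (E x) (- V)"
        using that by (intro mult_right_mono) (auto simp: infdist_nonneg)
      then show ?thesis using N by (auto simp: h_def g_def)
    qed
    then have "(\<lambda>n. h n x) \<longlonglongrightarrow> 1"
      by (intro tendsto_eventually) (auto simp: eventually_sequentially)
    then show ?thesis using True by simp
  next
    case F: False
    then have "h n x = 0" for n by (auto simp: h_def g_def)
    then show ?thesis using F by simp
  qed
  have int_lim: "(\<lambda>n. \<integral>x. h n x \<partial>\<rho>) \<longlonglongrightarrow> measure \<rho> (topspace X \<inter> E -` V)"
    if \<rho>: "prob_space \<rho>" "sets \<rho> = sets (borel_of X)" for \<rho>
  proof -
    interpret prob_space \<rho> by fact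
    have sp: "space \<rho> = topspace X"
      using sets_eq_imp_space_eq[OF \<rho>(2)] by (simp add: space_borel_of)
    have meas: "h n \<in> borel_measurable \<rho>" for n
      using borel_measurable_continuous_map[OF h] measurable_cong_sets[OF \<rho>(2) refl] by blast
    have meas': "(\<lambda>x. indicator (E -` V) x :: real) \<in> borel_measurable \<rho>"
      by (rule borel_measurable_LIMSEQ_metric[OF meas lim])
    have "(\<lambda>n. \<integral>x. h n x \<partial>\<rho>) \<longlonglongrightarrow> (\<integral>x. indicator (E -` V) x \<partial>\<rho>)"
      by (rule integral_dominated_convergence[where w = "\<lambda>_. 1"])
        (use lim g in \<open>auto simp: h_def intro!: meas[unfolded h_def] meas'\<close>)
    also have "(\<integral>x. indicator (E -` V) x \<partial>\<rho>) = measure \<rho> (topspace X \<inter> E -` V)"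
      by (simp add: sp Int_commute)
    finally show ?thesis .
  qed
  have "measure \<mu> (topspace X \<inter> E -` V) = measure \<nu> (topspace X \<inter> E -` V)"
    by (rule LIMSEQ_unique[OF int_lim[OF \<mu>]]) (use int_lim[OF \<nu>] eq[OF h bdd] in simp)
  then show ?thesis
    by (simp add: prob_space.finite_measure[OF \<mu>(1)] prob_space.finite_measure[OF \<nu>(1)]
        finite_measure.emeasure_eq_measure)
qed

text \<open>Bounded continuous functions separate probability measures as soon as every open set is pulled
  back from a metric space: open sets are then limits of continuous functions, and they form an
  intersection-stable generator of the Borel sets.\<close>

lemma prob_measure_eqI_continuous:
  fixes E :: "'a \<Rightarrow> 'b::metric_space"
  assumes X: "\<And>g :: 'b \<Rightarrow> real. continuous_on UNIV g \<Longrightarrow> continuous_map X euclideanreal (\<lambda>x. g (E x))"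
    and open_X: "\<And>U. openin X U \<Longrightarrow> \<exists>V. open V \<and> U = topspace X \<inter> E -` V"
    and \<mu>: "prob_space \<mu>" "sets \<mu> = sets (borel_of X)"
    and \<nu>: "prob_space \<nu>" "sets \<nu> = sets (borel_of X)"
    and eq: "\<And>h. continuous_map X euclideanreal h \<Longrightarrow> bounded (h ` topspace X) \<Longrightarrow>
      (\<integral>x. h x \<partial>\<mu>) = (\<integral>x. h x \<partial>\<nu>)"
  shows "\<mu> = \<nu>"
proof (rule measure_eqI_generator_eq[of "{U. openin X U}" "topspace X" _ _ "\<lambda>_. topspace X"])
  show "Int_stable {U. openin X U}"
    by (auto simp: Int_stable_def)
  show "emeasure \<mu> U = emeasure \<nu> U" if "U \<in> {U. openin X U}" for U
    using that open_X[of U] emeasure_open_eqI[OF X \<mu> \<nu> eq] by auto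
  show "emeasure \<mu> (topspace X) \<noteq> \<infinity>" for i :: nat
    by (simp add: prob_space.finite_measure[OF \<mu>(1)] finite_measure.emeasure_finite)
qed (use \<mu> \<nu> in \<open>auto simp: sets_borel_of dest: openin_subset\<close>)

section \<open>Integrals against counting measures\<close>

lemma counting_measures_sets:
  assumes "\<phi> \<in> counting_measures"
  shows "sets \<phi> = sets borel" "space \<phi> = UNIV"
  using assms sets_eq_imp_space_eq[of \<phi> borel] by (auto simp: counting_measures_def)

lemma emeasure_bounded_less_top:
  assumes "\<phi> \<in> counting_measures" "B \<in> sets borel" "bounded B"
  shows "emeasure \<phi> B < \<infinity>"
proof -
  obtain k :: nat where "emeasure \<phi> B = of_nat k"
    using assms unfolding counting_measures_def by blast
  then show ?thesis by (simp add: of_nat_less_top)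
qed

lemma continuous_bounded_support_bounded:
  fixes g :: "'a::euclidean_space \<Rightarrow> real"
  assumes "continuous_on UNIV g" "\<And>x. g x \<noteq> 0 \<Longrightarrow> norm x \<le> R"
  obtains C where "\<And>x. norm (g x) \<le> C"
proof -
  have "bounded (g ` cball 0 R)"
    by (intro compact_imp_bounded compact_continuous_image continuous_on_subset[OF assms(1)]) auto
  then obtain C where C: "C > 0" "\<And>x. x \<in> cball 0 R \<Longrightarrow> norm (g x) \<le> C"
    unfolding bounded_pos by (metis imageI)
  have "norm (g x) \<le> C" for x
    using C assms(2)[of x] by (cases "g x = 0") auto
  then show thesis by (rule that)
qed

lemma integrable_bounded_support:
  fixes g :: "'a::euclidean_space \<Rightarrow> real"
  assumes "\<phi> \<in> counting_measures" "continuous_on UNIV g" "\<And>x. g x \<noteq> 0 \<Longrightarrow> norm x \<le> R"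
  shows "integrable \<phi> g"
proof -
  obtain C where C: "\<And>x. norm (g x) \<le> C"
    using continuous_bounded_support_bounded[OF assms(2,3)] by blast
  have "set_integrable \<phi> (cball 0 R) g"
    unfolding set_integrable_def
  proof (rule integrableI_bounded_set_indicator)
    show "g \<in> borel_measurable \<phi>"
      using borel_measurable_continuous_onI[OF assms(2)] counting_measures_sets(1)[OF assms(1)]
        measurable_cong_sets by blast
    show "emeasure \<phi> (cball 0 R) < \<infinity>"
      by (rule emeasure_bounded_less_top) (use assms in auto)
    show "AE x in \<phi>. x \<in> cball 0 R \<longrightarrow> norm (g x) \<le> C"
      using C by auto
  qed (use counting_measures_sets[OF assms(1)] in auto)
  moreover have "(\<lambda>x. indicator (cball 0 R) x *\<^sub>R g x) = g"
  proof
    show "indicator (cball 0 R) x *\<^sub>R g x = g x" for x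
      using assms(3)[of x] by (cases "g x = 0") auto
  qed
  ultimately show ?thesis
    by (simp add: set_integrable_def)
qed

lemma continuous_map_integral_vague:
  fixes g :: "'a::euclidean_space \<Rightarrow> real"
  assumes "continuous_on UNIV g" "\<And>x. g x \<noteq> 0 \<Longrightarrow> norm x \<le> R"
  shows "continuous_map vague_topology euclideanreal (\<lambda>\<phi>. \<integral>x. g x \<partial>\<phi>)"
proof -
  have "bounded {x. g x \<noteq> 0}"
    using assms(2) by (intro boundedI) auto
  then have "compact (closure {x. g x \<noteq> 0})"
    by (simp add: compact_closure)
  with assms(1) show ?thesis
    unfolding vague_topology_def by (intro continuous_map_initial_topology) blast
qed

section \<open>Second countability of the vague topology\<close>

text \<open>A cutoff that equals \<open>1\<close> on the ball of radius \<open>n\<close> and vanishes outside that of radius \<open>n + 1\<close>.\<close>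

definition bump :: "nat \<Rightarrow> 'a::euclidean_space \<Rightarrow> real" where
  "bump n x = max 0 (min 1 (real n + 1 - norm x))"

lemma bump_nonneg: "0 \<le> bump n x"
  by (simp add: bump_def)

lemma bump_eq_1: "norm x \<le> real n \<Longrightarrow> bump n x = 1"
  by (simp add: bump_def)

lemma bump_nonzeroD: "bump n x \<noteq> 0 \<Longrightarrow> norm x \<le> real n + 1"
  by (simp add: bump_def split: if_splits)

lemma continuous_on_bump: "continuous_on UNIV (bump n)"
  unfolding bump_def by (intro continuous_intros)

definition monomial :: "'a::euclidean_space list \<Rightarrow> 'a \<Rightarrow> real" where
  "monomial L x = (\<Prod>b\<leftarrow>L. x \<bullet> b)"

lemma continuous_on_monomial: "continuous_on UNIV (monomial L)"
  unfolding monomial_def by (induction L) (auto intro!: continuous_intros)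

text \<open>A countable family in \<open>C\<^sub>c\<close>. Its linear span consists of all truncated polynomials, which is
  enough to approximate every other test function (lemma \<open>integral_continuous_test_integrals\<close>).\<close>

definition test_functions :: "('a::euclidean_space \<Rightarrow> real) set" where
  "test_functions = (\<lambda>(n, L). \<lambda>x. bump n x * monomial L x) ` (UNIV \<times> lists Basis)"

text \<open>The embedding of the counting measures into the space of real sequences that turns out to induce
  the vague topology.\<close>

definition test_integrals :: "'a::euclidean_space measure \<Rightarrow> nat \<Rightarrow> real" where
  "test_integrals \<phi> k = (\<integral>x. from_nat_into test_functions k x \<partial>\<phi>)"

lemma test_integrals_exists:
  assumes "L \<in> lists (Basis :: 'a::euclidean_space set)"
  obtains k where "\<And>\<phi>. test_integrals \<phi> k = (\<integral>x. bump n x * monomial L x \<partial>\<phi>)"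
proof -
  have "countable (test_functions :: ('a \<Rightarrow> real) set)"
    unfolding test_functions_def
    by (intro countable_image countable_SIGMA countable_lists) (auto intro: countable_finite)
  moreover have "(\<lambda>x. bump n x * monomial L x) \<in> test_functions"
    using assms unfolding test_functions_def by force
  ultimately obtain k where "from_nat_into test_functions k = (\<lambda>x. bump n x * monomial L x)"
    using from_nat_into_surj by metis
  then show thesis
    by (intro that[of k]) (simp add: test_integrals_def)
qed

lemma test_integrals_of_test_function:
  obtains n L where "\<And>\<phi>. test_integrals \<phi> k = (\<integral>x. bump n x * monomial L x \<partial>(\<phi> :: 'a::euclidean_space measure))"
proof -
  have "test_functions \<noteq> ({} :: ('a \<Rightarrow> real) set)"
    unfolding test_functions_def by auto
  then have "from_nat_into test_functions k \<in> (test_functions :: ('a \<Rightarrow> real) set)"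
    by (rule from_nat_into)
  then obtain n L where "from_nat_into (test_functions :: ('a \<Rightarrow> real) set) k = (\<lambda>x. bump n x * monomial L x)"
    unfolding test_functions_def by auto
  then show thesis
    by (intro that[of n L]) (simp add: test_integrals_def)
qed

lemma continuous_map_test_integrals:
  fixes g :: "(nat \<Rightarrow> real) \<Rightarrow> real"
  assumes "continuous_on UNIV g"
  shows "continuous_map vague_topology euclideanreal (\<lambda>\<phi>. g (test_integrals \<phi>))"
proof -
  have "continuous_map vague_topology euclideanreal (\<lambda>\<phi> :: 'a measure. test_integrals \<phi> k)" for k
  proof -
    obtain n L where k: "\<And>\<phi> :: 'a measure. test_integrals \<phi> k = (\<integral>x. bump n x * monomial L x \<partial>\<phi>)"
      using test_integrals_of_test_function by blast
    show ?thesis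
      unfolding k by (rule continuous_map_integral_vague[of _ "real n + 1"])
        (auto intro!: continuous_intros continuous_on_bump continuous_on_monomial dest: bump_nonzeroD)
  qed
  then have "continuous_map vague_topology euclidean (test_integrals :: 'a measure \<Rightarrow> _)"
    by (simp add: euclidean_product_topology[symmetric] continuous_map_componentwise_UNIV)
  moreover have "continuous_map euclidean euclideanreal g"
    using assms by simp
  ultimately show ?thesis
    using continuous_map_compose[of vague_topology euclidean test_integrals euclideanreal g]
    by (simp add: o_def)
qed

inductive_set monomial_span :: "('a::euclidean_space \<Rightarrow> real) set" where
  monomial: "L \<in> lists Basis \<Longrightarrow> monomial L \<in> monomial_span"
| scale: "p \<in> monomial_span \<Longrightarrow> (\<lambda>x. c * p x) \<in> monomial_span"
| add: "p \<in> monomial_span \<Longrightarrow> q \<in> monomial_span \<Longrightarrow> (\<lambda>x. p x + q x) \<in> monomial_span"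

lemma monomial_span_sum:
  assumes "\<And>i. i \<in> I \<Longrightarrow> p i \<in> monomial_span"
  shows "(\<lambda>x. \<Sum>i\<in>I. p i x) \<in> monomial_span"
  using assms
proof (induction I rule: infinite_finite_induct)
  case (insert i I)
  then show ?case using monomial_span.add[of "p i" "\<lambda>x. \<Sum>i\<in>I. p i x"] by simp
qed (use monomial_span.scale[OF monomial_span.monomial[of "[]"], of 0] in simp_all)

lemma monomial_span_coordinate:
  assumes "q \<in> monomial_span" "b \<in> Basis"
  shows "(\<lambda>x. (x \<bullet> b) * q x) \<in> monomial_span"
  using assms(1)
proof induction
  case (monomial L)
  then have "monomial (b # L) \<in> monomial_span"
    using assms(2) by (intro monomial_span.monomial) auto
  then show ?case by (simp add: monomial_def[abs_def])
next
  case (scale p c)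
  then show ?case
    using monomial_span.scale[OF scale.IH, of c] by (simp add: mult.left_commute)
next
  case (add p q)
  then show ?case
    using monomial_span.add[OF add.IH] by (simp add: distrib_left)
qed

text \<open>The functions \<open>p\<close> whose multiples \<open>p * q\<close> stay in the span for all \<open>q\<close> in the span form an algebra,
  for trivial reasons; it contains the constants and the linear functions. Taking \<open>q = 1\<close> shows that
  the polynomials lie in the span. This avoids multiplying out products of linear combinations.\<close>

lemma real_polynomial_function_monomial_span:
  assumes "real_polynomial_function p"
  shows "p \<in> monomial_span"
proof -
  have "(\<lambda>x. p x * q x) \<in> monomial_span" if "q \<in> monomial_span" for q
    using assms that
  proof (induction arbitrary: q)
    case (linear f)
    interpret bounded_linear f by fact
    have expand: "f x = (\<Sum>b\<in>Basis. f b * (x \<bullet> b))" for x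
    proof -
      have "f x = f (\<Sum>b\<in>Basis. (x \<bullet> b) *\<^sub>R b)" by (simp add: euclidean_representation)
      also have "\<dots> = (\<Sum>b\<in>Basis. f b * (x \<bullet> b))"
        by (simp add: sum scaleR mult.commute)
      finally show ?thesis .
    qed
    have "(\<lambda>x. f x * q x) = (\<lambda>x. \<Sum>b\<in>Basis. f b * ((x \<bullet> b) * q x))"
      by (subst expand) (simp add: sum_distrib_right mult.assoc)
    also have "\<dots> \<in> monomial_span"
      by (intro monomial_span_sum monomial_span.scale monomial_span_coordinate linear.prems)
    finally show ?case .
  next
    case (const c)
    then show ?case by (rule monomial_span.scale)
  next
    case (add f g)
    then show ?case using monomial_span.add[of "\<lambda>x. f x * q x" "\<lambda>x. g x * q x"]
      by (simp add: distrib_right)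
  next
    case (mult f g)
    then show ?case by (simp add: mult.assoc)
  qed
  from this[OF monomial_span.monomial[of "[]"]] show ?thesis
    by (simp add: monomial_def)
qed

text \<open>The integral of a truncated polynomial is a finite linear combination of test integrals. Of this
  only the continuity of the combination \<open>l\<close> on the space of sequences is recorded.\<close>

lemma integral_polynomial_test_integrals:
  fixes p :: "'a::euclidean_space \<Rightarrow> real"
  assumes "p \<in> monomial_span"
  shows "continuous_on UNIV p \<and> (\<exists>l. continuous_on UNIV l \<and>
    (\<forall>\<phi>\<in>counting_measures. (\<integral>x. bump n x * p x \<partial>\<phi>) = l (test_integrals \<phi>)))"
  using assms
proof induction
  case (monomial L)
  then obtain k where "\<And>\<phi>. test_integrals \<phi> k = (\<integral>x. bump n x * monomial L x \<partial>\<phi>)"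
    using test_integrals_exists by blast
  then show ?case
    by (intro conjI continuous_on_monomial exI[of _ "\<lambda>y. y k"]) (auto intro!: continuous_intros)
next
  case (scale p c)
  then obtain l where l: "continuous_on UNIV l"
    "\<forall>\<phi>\<in>counting_measures. (\<integral>x. bump n x * p x \<partial>\<phi>) = l (test_integrals \<phi>)"
    by blast
  have "(\<integral>x. bump n x * (c * p x) \<partial>\<phi>) = c * (\<integral>x. bump n x * p x \<partial>\<phi>)" for \<phi>
    by (simp add: mult.left_commute)
  then show ?case
    using scale.IH l by (intro conjI exI[of _ "\<lambda>y. c * l y"]) (auto intro!: continuous_intros)
next
  case (add p q)
  then obtain l l' where l: "continuous_on UNIV l"
    "\<forall>\<phi>\<in>counting_measures. (\<integral>x. bump n x * p x \<partial>\<phi>) = l (test_integrals \<phi>)"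
    and l': "continuous_on UNIV l'"
    "\<forall>\<phi>\<in>counting_measures. (\<integral>x. bump n x * q x \<partial>\<phi>) = l' (test_integrals \<phi>)"
    by blast
  have int: "integrable \<phi> (\<lambda>x. bump n x * r x)"
    if "\<phi> \<in> counting_measures" "continuous_on UNIV r" for \<phi> and r :: "'a \<Rightarrow> real"
    by (rule integrable_bounded_support[of _ _ "real n + 1"])
      (use that in \<open>auto intro!: continuous_intros continuous_on_bump dest: bump_nonzeroD\<close>)
  have "(\<integral>x. bump n x * (p x + q x) \<partial>\<phi>) = (\<integral>x. bump n x * p x \<partial>\<phi>) + (\<integral>x. bump n x * q x \<partial>\<phi>)"
    if "\<phi> \<in> counting_measures" for \<phi>
    unfolding distrib_left
    by (rule Bochner_Integration.integral_add) (use int that add.IH in auto)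
  then show ?case
    using add.IH l l' by (intro conjI exI[of _ "\<lambda>y. l y + l' y"]) (auto intro!: continuous_intros)
qed

text \<open>Let \<open>g\<close> be supported in the ball of radius \<open>n\<close>. Stone--Weierstrass on the ball of radius \<open>n + 1\<close> gives
  a polynomial \<open>p\<close> with \<open>\<bar>g - bump n * p\<bar> \<le> d * bump n\<close> everywhere. Hence the integral of \<open>g\<close> differs
  from that of \<open>bump n * p\<close>, which is controlled by finitely many test integrals, by at most
  \<open>d \<integral>bump n\<close>. The last integral is itself a test integral and so stays bounded near \<open>\<phi>\<close>: this is
  what makes the approximation locally uniform although counting measures have no common mass
  bound.\<close>

lemma integral_continuous_test_integrals:
  fixes g :: "'a::euclidean_space \<Rightarrow> real"
  assumes g: "continuous_on UNIV g" "\<And>x. g x \<noteq> 0 \<Longrightarrow> norm x \<le> R"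
    and \<phi>: "\<phi> \<in> counting_measures" and "e > 0"
  shows "\<exists>V. open V \<and> test_integrals \<phi> \<in> V \<and>
    (\<forall>\<psi>\<in>counting_measures. test_integrals \<psi> \<in> V \<longrightarrow> \<bar>(\<integral>x. g x \<partial>\<psi>) - (\<integral>x. g x \<partial>\<phi>)\<bar> < e)"
proof -
  obtain n :: nat where n: "R \<le> real n"
    using real_arch_simple by blast
  define C where "C = (\<integral>x. bump n x \<partial>\<phi>)"
  \<comment> \<open>On the neighbourhood \<open>V\<close> below, the integral of \<open>bump n\<close> is at most \<open>C + 1\<close>, so that each of the two
     approximation errors is at most \<open>e / 3\<close>.\<close>
  define d where "d = e / (3 * (C + 1))"
  have "C \<ge> 0" unfolding C_def by (simp add: bump_nonneg)
  then have d: "d > 0" "d * (C + 1) = e / 3"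
    using \<open>e > 0\<close> by (auto simp: d_def field_simps)
  have "continuous_on (cball 0 (real n + 1)) g"
    using continuous_on_subset[OF g(1)] by auto
  then obtain p where p: "real_polynomial_function p"
    "\<And>x. x \<in> cball 0 (real n + 1) \<Longrightarrow> \<bar>g x - p x\<bar> < d"
    using Stone_Weierstrass_real_polynomial_function[OF compact_cball _ d(1)] by metis
  have "continuous_on UNIV p" and "\<exists>l. continuous_on UNIV l \<and>
    (\<forall>\<psi>\<in>counting_measures. (\<integral>x. bump n x * p x \<partial>\<psi>) = l (test_integrals \<psi>))"
    using integral_polynomial_test_integrals[OF real_polynomial_function_monomial_span[OF p(1)]]
    by blast+
  then obtain l where l: "continuous_on UNIV l"
    "\<And>\<psi>. \<psi> \<in> counting_measures \<Longrightarrow> (\<integral>x. bump n x * p x \<partial>\<psi>) = l (test_integrals \<psi>)"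
    by blast
  obtain k where k: "\<And>\<psi> :: 'a measure. test_integrals \<psi> k = (\<integral>x. bump n x \<partial>\<psi>)"
    using test_integrals_exists[of "[]" n] by (auto simp: monomial_def)
  have pointwise: "\<bar>g x - bump n x * p x\<bar> \<le> d * bump n x" for x
  proof (cases "norm x \<le> real n + 1")
    case True
    have "g x = bump n x * g x"
      using g(2)[of x] n bump_eq_1[of x n] by (cases "g x = 0") auto
    then have "\<bar>g x - bump n x * p x\<bar> = bump n x * \<bar>g x - p x\<bar>"
      using bump_nonneg[of n x] by (metis abs_mult abs_of_nonneg right_diff_distrib)
    also have "\<dots> \<le> bump n x * d"
      using True p(2)[of x] bump_nonneg[of n x] by (intro mult_left_mono) auto
    finally show ?thesis by (simp add: mult.commute)
  next
    case False
    then show ?thesis using g(2)[of x] n bump_nonzeroD[of n x] by force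
  qed
  have approx: "\<bar>(\<integral>x. g x \<partial>\<psi>) - l (test_integrals \<psi>)\<bar> \<le> d * test_integrals \<psi> k"
    if \<psi>: "\<psi> \<in> counting_measures" for \<psi>
  proof -
    have int: "integrable \<psi> g" "integrable \<psi> (bump n)"
      using integrable_bounded_support[OF \<psi> g]
        integrable_bounded_support[OF \<psi> continuous_on_bump bump_nonzeroD] by auto
    have intp: "integrable \<psi> (\<lambda>x. bump n x * p x)"
      by (rule integrable_bounded_support[OF \<psi>, of _ "real n + 1"])
        (use \<open>continuous_on UNIV p\<close> in
          \<open>auto intro!: continuous_intros continuous_on_bump dest: bump_nonzeroD\<close>)
    have "\<bar>(\<integral>x. g x \<partial>\<psi>) - l (test_integrals \<psi>)\<bar> = \<bar>\<integral>x. g x - bump n x * p x \<partial>\<psi>\<bar>"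
      using int intp l(2)[OF \<psi>] by simp
    also have "\<dots> \<le> (\<integral>x. \<bar>g x - bump n x * p x\<bar> \<partial>\<psi>)"
      by (rule integral_abs_bound)
    also have "\<dots> \<le> (\<integral>x. d * bump n x \<partial>\<psi>)"
      using int intp pointwise by (intro integral_mono) auto
    also have "\<dots> = d * test_integrals \<psi> k"
      by (simp add: k)
    finally show ?thesis .
  qed
  define V where "V = {y. \<bar>l y - l (test_integrals \<phi>)\<bar> < e / 3} \<inter> {y. \<bar>y k - C\<bar> < 1}"
  have "open V"
    unfolding V_def by (intro open_Int open_Collect_less continuous_intros l(1)) auto
  moreover have "test_integrals \<phi> \<in> V"
    using \<open>e > 0\<close> by (simp add: V_def C_def k)
  moreover have "\<bar>(\<integral>x. g x \<partial>\<psi>) - (\<integral>x. g x \<partial>\<phi>)\<bar> < e"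
    if \<psi>: "\<psi> \<in> counting_measures" "test_integrals \<psi> \<in> V" for \<psi>
  proof -
    have "d * test_integrals \<psi> k \<le> e / 3" "d * test_integrals \<phi> k \<le> e / 3"
      using \<psi>(2) d k[of \<phi>] mult_left_mono[of "test_integrals \<psi> k" "C + 1" d]
        mult_left_mono[of "test_integrals \<phi> k" "C + 1" d]
      by (auto simp: V_def C_def)
    moreover have "\<bar>l (test_integrals \<psi>) - l (test_integrals \<phi>)\<bar> < e / 3"
      using \<psi>(2) by (simp add: V_def)
    ultimately show ?thesis
      using approx[OF \<psi>(1)] approx[OF \<phi>] by linarith
  qed
  ultimately show ?thesis
    by (intro exI[of _ V]) simp
qed

lemma open_vague_topology:
  assumes "openin vague_topology U"
  shows "\<exists>V. open V \<and> U = counting_measures \<inter> test_integrals -` V"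
proof -
  let ?F = "{\<lambda>\<phi>. \<integral>x. g x \<partial>\<phi> | g. continuous_on UNIV g \<and> compact (closure {x. g x \<noteq> 0})}
    :: ('a measure \<Rightarrow> real) set"
  have "(\<lambda>\<phi>. \<integral>x. 0 \<partial>\<phi>) \<in> ?F"
    by (intro CollectI exI[of _ "\<lambda>x. 0"]) simp
  then have nonempty: "?F \<noteq> {}"
    by blast
  have approx: "\<exists>V. open V \<and> test_integrals \<phi> \<in> V \<and>
      (\<forall>\<psi>\<in>counting_measures. test_integrals \<psi> \<in> V \<longrightarrow> \<bar>h \<psi> - h \<phi>\<bar> < e)"
    if h: "h \<in> ?F" and \<phi>: "\<phi> \<in> counting_measures" "e > 0"
    for h :: "'a measure \<Rightarrow> real" and \<phi> and e :: real
  proof -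
    obtain g where g: "h = (\<lambda>\<phi>. \<integral>x. g x \<partial>\<phi>)" "continuous_on UNIV g"
      "compact (closure {x. g x \<noteq> 0})"
      using h by blast
    from g(3) have "bounded {x. g x \<noteq> 0}"
      by (meson bounded_subset closure_subset compact_imp_bounded)
    then obtain R where "\<And>x. g x \<noteq> 0 \<Longrightarrow> norm x \<le> R"
      unfolding bounded_iff by blast
    from integral_continuous_test_integrals[OF g(2) this \<phi>] show ?thesis
      unfolding g(1) .
  qed
  show ?thesis
    by (rule open_sets_initial_topology[OF nonempty approx assms[unfolded vague_topology_def]])
qed

lemma open_vague_topology0:
  assumes "openin vague_topology0 U"
  shows "\<exists>V. open V \<and> U = counting_measures0 \<inter> test_integrals -` V"
proof -
  obtain W where W: "openin vague_topology W" "U = W \<inter> counting_measures0"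
    using assms by (auto simp: vague_topology0_def openin_subtopology)
  obtain V where "open V" "W = counting_measures \<inter> test_integrals -` V"
    using open_vague_topology[OF W(1)] by blast
  then show ?thesis
    using W(2) by (intro exI[of _ V]) (auto simp: counting_measures0_def)
qed

lemma prob_measure_eqI_vague0:
  assumes "prob_space \<mu>" "sets \<mu> = sets (borel_of vague_topology0)"
    and "prob_space \<nu>" "sets \<nu> = sets (borel_of vague_topology0)"
    and "\<And>h. continuous_map vague_topology0 euclideanreal h \<Longrightarrow>
      bounded (h ` topspace vague_topology0) \<Longrightarrow> (\<integral>x. h x \<partial>\<mu>) = (\<integral>x. h x \<partial>\<nu>)"
  shows "\<mu> = \<nu>"
proof -
  have cont: "continuous_map vague_topology0 euclideanreal (\<lambda>\<phi>. g (test_integrals \<phi>))"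
    if "continuous_on UNIV g" for g :: "(nat \<Rightarrow> real) \<Rightarrow> real"
    unfolding vague_topology0_def
    by (rule continuous_map_from_subtopology[OF continuous_map_test_integrals[OF that]])
  have opn: "\<exists>V. open V \<and> U = topspace vague_topology0 \<inter> test_integrals -` V"
    if "openin vague_topology0 U" for U
    using open_vague_topology0[OF that] by (simp add: topspace_vague_topology0)
  show ?thesis
    by (rule prob_measure_eqI_continuous[OF cont opn assms])
qed

section \<open>Measurability of the point-shift\<close>

lemma emeasure_translate:
  assumes "\<phi> \<in> counting_measures" "B \<in> sets borel"
  shows "emeasure (translate t \<phi>) B = emeasure \<phi> ((\<lambda>x. x - t) -` B)"
  unfolding translate_def
  using assms counting_measures_sets[OF assms(1)] measurable_cong_sets[of \<phi> borel borel borel]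
  by (subst emeasure_distr) auto

lemma integral_translate:
  assumes "\<phi> \<in> counting_measures" "continuous_on UNIV g"
  shows "(\<integral>x. g x \<partial>translate t \<phi>) = (\<integral>x. g (x - t) \<partial>\<phi> :: real)"
  unfolding translate_def
  using counting_measures_sets(1)[OF assms(1)] borel_measurable_continuous_onI[OF assms(2)]
    measurable_cong_sets[of \<phi> borel borel borel]
  by (intro integral_distr) auto

lemma translate_counting_measures:
  assumes "\<phi> \<in> counting_measures"
  shows "translate t \<phi> \<in> counting_measures"
proof -
  have "\<exists>k::nat. emeasure (translate t \<phi>) B = of_nat k" if B: "B \<in> sets borel" "bounded B" for B
  proof -
    have "(\<lambda>x. x - t) -` B = (\<lambda>x. x + t) ` B"
      by (auto intro!: image_eqI[of _ _ "_ - t"])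
    then have "bounded ((\<lambda>x. x - t) -` B)"
      using bounded_translation[OF B(2), of t] by (simp add: add.commute)
    moreover have "(\<lambda>x. x - t) -` B \<in> sets borel"
      using measurable_sets[of "\<lambda>x. x - t" borel borel B] B(1) by simp
    ultimately show ?thesis
      using assms by (simp add: emeasure_translate[OF assms B(1)] counting_measures_def)
  qed
  then show ?thesis
    by (simp add: counting_measures_def translate_def)
qed

text \<open>The measures of the balls shrinking to a point of the support are positive integers, hence at
  least \<open>1\<close>, and so is their limit.\<close>

lemma emeasure_singleton_support:
  assumes \<phi>: "\<phi> \<in> counting_measures" and "x \<in> support \<phi>"
  shows "emeasure \<phi> {x} > 0"
proof -
  define A where "A n = ball x (1 / real (Suc n))" for n
  have sets: "A n \<in> sets borel" "bounded (A n)" for n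
    by (auto simp: A_def)
  have "(\<lambda>n. emeasure \<phi> (A n)) \<longlonglongrightarrow> emeasure \<phi> (\<Inter>n. A n)"
  proof (rule Lim_emeasure_decseq)
    show "decseq A"
      unfolding A_def by (intro decseq_SucI subset_ball) (simp add: field_simps)
    show "emeasure \<phi> (A n) \<noteq> \<infinity>" for n
      using emeasure_bounded_less_top[OF \<phi> sets, of n] by simp
  qed (use sets counting_measures_sets(1)[OF \<phi>] in auto)
  moreover have "1 \<le> emeasure \<phi> (A n)" for n
  proof -
    have "emeasure \<phi> (A n) > 0"
      using assms(2) by (auto simp: support_def A_def)
    moreover obtain k :: nat where "emeasure \<phi> (A n) = of_nat k"
      using \<phi> sets[of n] by (auto simp: counting_measures_def)
    ultimately show ?thesis
      by (cases k) auto
  qed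
  ultimately have "1 \<le> emeasure \<phi> (\<Inter>n. A n)"
    by (intro LIMSEQ_le_const) auto
  moreover have "(\<Inter>n. A n) = {x}"
  proof (intro equalityI subsetI)
    fix y assume y: "y \<in> (\<Inter>n. A n)"
    show "y \<in> {x}"
    proof (rule ccontr)
      assume "y \<notin> {x}"
      then obtain n where "inverse (real (Suc n)) < dist x y"
        using reals_Archimedean[of "dist x y"] by auto
      moreover have "dist x y < 1 / real (Suc n)"
        using y by (auto simp: A_def)
      ultimately show False by (simp add: inverse_eq_divide)
    qed
  qed (auto simp: A_def)
  ultimately show ?thesis
    by (metis less_le_trans zero_less_one)
qed

text \<open>The origin of the shifted measure corresponds to the point \<open>f \<phi>\<close> of \<open>\<phi>\<close>.\<close>

lemma point_shift_counting_measures0: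
  assumes "point_map f" "\<phi> \<in> counting_measures0"
  shows "point_shift f \<phi> \<in> counting_measures0"
proof -
  have \<phi>: "\<phi> \<in> counting_measures" and "f \<phi> \<in> support \<phi>"
    using assms by (auto simp: point_map_def counting_measures0_def)
  moreover have "(\<lambda>x. x - f \<phi>) -` {0} = {f \<phi>}"
    by auto
  ultimately have "emeasure (point_shift f \<phi>) {0} > 0"
    using emeasure_singleton_support[OF \<phi>] by (simp add: point_shift_def emeasure_translate)
  then show ?thesis
    using translate_counting_measures[OF \<phi>] by (simp add: counting_measures0_def point_shift_def)
qed

text \<open>For a constant shift \<open>t\<close> the map is vaguely continuous, hence for a shift taking finitely many
  values it is measurable. A general \<open>f\<close> is a pointwise limit of simple functions \<open>s\<^sub>i\<close> with
  \<open>norm (s\<^sub>i \<phi>) \<le> 2 * norm (f \<phi>)\<close>; this bound keeps the supports of the shifted functions, for a fixed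
  \<open>\<phi>\<close>, in a common ball, so that dominated convergence applies.\<close>

lemma measurable_integral_shift:
  fixes g :: "'a::euclidean_space \<Rightarrow> real"
  assumes g: "continuous_on UNIV g" "\<And>x. g x \<noteq> 0 \<Longrightarrow> norm x \<le> R"
    and f: "f \<in> borel_of vague_topology0 \<rightarrow>\<^sub>M borel"
  shows "(\<lambda>\<phi>. \<integral>x. g (x - f \<phi>) \<partial>\<phi>) \<in> borel_measurable (borel_of vague_topology0)"
proof -
  let ?N = "borel_of vague_topology0 :: 'a measure measure"
  have space: "space ?N = counting_measures0"
    by (simp add: space_borel_of topspace_vague_topology0)
  have shift: "continuous_on UNIV (\<lambda>x. g (x - t))" for t
    by (intro continuous_on_compose2[OF g(1)] continuous_intros) auto
  have support: "norm x \<le> R + norm t" if "g (x - t) \<noteq> 0" for x t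
    using g(2)[OF that] norm_triangle_sub[of x t] by linarith
  have fixed: "(\<lambda>\<phi>. \<integral>x. g (x - t) \<partial>\<phi>) \<in> borel_measurable ?N" for t
    unfolding vague_topology0_def
    by (intro borel_measurable_continuous_map continuous_map_from_subtopology
        continuous_map_integral_vague[OF shift support])
  obtain s where s: "\<And>i. simple_function ?N (s i)"
    "\<And>\<phi>. \<phi> \<in> space ?N \<Longrightarrow> (\<lambda>i. s i \<phi>) \<longlonglongrightarrow> f \<phi>"
    "\<And>i \<phi>. \<phi> \<in> space ?N \<Longrightarrow> norm (s i \<phi>) \<le> 2 * norm (f \<phi>)"
    using borel_measurable_implies_sequence_metric[OF f, of 0] by (simp add: dist_norm) metis
  obtain C where C: "\<And>x. norm (g x) \<le> C"
    using continuous_bounded_support_bounded[OF g] by blast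
  show ?thesis
  proof (rule borel_measurable_LIMSEQ_metric)
    fix i
    show "(\<lambda>\<phi>. \<integral>x. g (x - s i \<phi>) \<partial>\<phi>) \<in> borel_measurable ?N"
    proof (rule measurable_compose_countable'[where I = "s i ` space ?N"])
      show "s i \<in> ?N \<rightarrow>\<^sub>M count_space (s i ` space ?N)"
        using simple_functionD(2)[OF s(1)] by (auto simp: measurable_def)
      show "countable (s i ` space ?N)"
        using simple_functionD(1)[OF s(1)] by (rule countable_finite)
    qed (rule fixed)
  next
    fix \<phi> assume \<phi>: "\<phi> \<in> space ?N"
    then have cm: "\<phi> \<in> counting_measures"
      by (simp add: space counting_measures0_def)
    have meas: "(\<lambda>x. g (x - t)) \<in> borel_measurable \<phi>" for t
      by (rule borel_measurable_integrable[OF integrable_bounded_support[OF cm shift support]])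
    let ?K = "cball 0 (R + 2 * norm (f \<phi>))"
    show "(\<lambda>i. \<integral>x. g (x - s i \<phi>) \<partial>\<phi>) \<longlonglongrightarrow> (\<integral>x. g (x - f \<phi>) \<partial>\<phi>)"
    proof (rule integral_dominated_convergence[where w = "\<lambda>x. C * indicator ?K x"])
      show "integrable \<phi> (\<lambda>x. C * indicator ?K x)"
        using emeasure_bounded_less_top[OF cm, of ?K] counting_measures_sets[OF cm]
        by (intro integrable_mult_right integrable_real_indicator) auto
      have "(\<lambda>i. g (x - s i \<phi>)) \<longlonglongrightarrow> g (x - f \<phi>)" for x
        using g(1) s(2)[OF \<phi>] by (intro continuous_on_tendsto_compose[OF g(1)] tendsto_intros) auto
      then show "AE x in \<phi>. (\<lambda>i. g (x - s i \<phi>)) \<longlonglongrightarrow> g (x - f \<phi>)"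
        by simp
      have "norm (g (x - s i \<phi>)) \<le> C * indicator ?K x" for x i
      proof (cases "g (x - s i \<phi>) = 0")
        case True
        moreover have "C \<ge> 0"
          using C[of 0] norm_ge_zero order_trans by blast
        ultimately show ?thesis by (auto simp: indicator_def)
      next
        case False
        then have "x \<in> ?K"
          using support[of x "s i \<phi>"] s(3)[OF \<phi>, of i] by simp
        then show ?thesis using C[of "x - s i \<phi>"] by simp
      qed
      then show "AE x in \<phi>. norm (g (x - s i \<phi>)) \<le> C * indicator ?K x" for i
        by simp
    qed (fact meas)+
  qed
qed

text \<open>The open sets are preimages under \<open>test_integrals\<close>, so only countably many real functions need to
  be measurable.\<close>

lemma measurable_point_shift:
  assumes "point_map f"
  shows "point_shift f \<in> borel_of vague_topology0 \<rightarrow>\<^sub>M borel_of vague_topology0"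
proof (rule measurable_borel_of)
  let ?N = "borel_of vague_topology0 :: 'a measure measure"
  have space: "space ?N = counting_measures0"
    by (simp add: space_borel_of topspace_vague_topology0)
  show maps: "point_shift f \<in> space ?N \<rightarrow> topspace vague_topology0"
    using point_shift_counting_measures0[OF assms] by (simp add: space topspace_vague_topology0)
  have "(\<lambda>\<phi>. test_integrals (point_shift f \<phi>) k) \<in> borel_measurable ?N" for k
  proof -
    obtain n L where k: "\<And>\<phi> :: 'a measure. test_integrals \<phi> k = (\<integral>x. bump n x * monomial L x \<partial>\<phi>)"
      using test_integrals_of_test_function by blast
    have cont: "continuous_on UNIV (\<lambda>x. bump n x * monomial L x)"
      by (intro continuous_intros continuous_on_bump continuous_on_monomial)
    have "(\<lambda>\<phi>. \<integral>x. bump n (x - f \<phi>) * monomial L (x - f \<phi>) \<partial>\<phi>) \<in> borel_measurable ?N"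
      by (rule measurable_integral_shift[OF cont, of "real n + 1"])
        (use assms in \<open>auto simp: point_map_def dest: bump_nonzeroD\<close>)
    then show ?thesis
      by (rule measurable_cong[THEN iffD2, rotated])
        (simp add: k point_shift_def integral_translate cont space counting_measures0_def)
  qed
  then have meas: "(\<lambda>\<phi>. test_integrals (point_shift f \<phi>)) \<in> borel_measurable ?N"
    by (rule measurable_coordinatewise_then_product)
  show "point_shift f -` U \<inter> space ?N \<in> sets ?N" if U: "openin vague_topology0 U" for U
  proof -
    obtain V where V: "open V" "U = counting_measures0 \<inter> test_integrals -` V"
      using open_vague_topology0[OF U] by blast
    then have "point_shift f -` U \<inter> space ?N = (\<lambda>\<phi>. test_integrals (point_shift f \<phi>)) -` V \<inter> space ?N"
      using maps by (auto simp: topspace_vague_topology0)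
    also have "\<dots> \<in> sets ?N"
      using meas V(1) by (intro measurable_sets) auto
    finally show ?thesis .
  qed
qed

section \<open>Cesaro means\<close>

lemma sets_palm_distribution:
  fixes \<Phi> :: "'w \<Rightarrow> 'a::euclidean_space measure"
  shows "sets (palm_distribution M \<theta> \<Phi> B) = sets (borel_of vague_topology0)"
proof -
  have "counting_measures0 \<subseteq> topspace (vague_topology :: 'a measure topology)"
    by (auto simp: topspace_vague_topology counting_measures0_def)
  then show ?thesis
    unfolding palm_distribution_def vague_topology0_def
    by (simp add: sets_borel_of_subtopology sets_restrict_space)
qed

lemma measurable_point_shift_power:
  assumes "point_map f"
  shows "point_shift f ^^ i \<in> borel_of vague_topology0 \<rightarrow>\<^sub>M borel_of vague_topology0"
proof (induction i)
  case (Suc i)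
  then show ?case
    using measurable_comp[OF Suc measurable_point_shift[OF assms]] by (simp add: comp_def)
qed (simp add: id_def)

text \<open>By convention \<open>measure_of\<close> yields the zero measure if the given set function is not a measure.
  A Cesaro mean that is a probability is not zero, so its set function is the one in the
  definition.\<close>

lemma emeasure_cesaro:
  assumes "prob_space (point_map_cesaro f \<mu> n)" and A: "A \<in> sets (borel_of vague_topology0)"
  shows "emeasure (point_map_cesaro f \<mu> n) A
    = (\<Sum>i<n. emeasure (point_map_prob f \<mu> i) A) / of_nat n"
proof -
  let ?N = "borel_of vague_topology0 :: 'a measure measure"
  let ?m = "\<lambda>A. (\<Sum>i<n. emeasure (point_map_prob f \<mu> i) A) / of_nat n"
  have sigma: "sigma_sets (topspace vague_topology0) (sets ?N) = sets ?N"
    by (metis sets.sigma_sets_eq space_borel_of)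
  have conv: "emeasure (point_map_cesaro f \<mu> n) X =
      (if X \<in> sets ?N \<and> measure_space (topspace vague_topology0) (sets ?N) ?m then ?m X else 0)" for X
    unfolding point_map_cesaro_def emeasure_measure_of_conv sigma ..
  have "measure_space (topspace vague_topology0) (sets ?N) ?m"
    using prob_space.emeasure_space_1[OF assms(1)] unfolding conv by (auto split: if_splits)
  with A show ?thesis by (simp add: conv)
qed

lemma sets_cesaro:
  fixes f :: "'a::euclidean_space measure \<Rightarrow> 'a"
  shows "sets (point_map_cesaro f \<mu> n) = sets (borel_of vague_topology0)"
  using sets.sigma_sets_eq[of "borel_of vague_topology0 :: 'a measure measure"]
    sets.space_closed[of "borel_of vague_topology0 :: 'a measure measure"]
  by (simp add: point_map_cesaro_def space_borel_of)

text \<open>Convergence in \<open>weak_topology\<close> makes the Cesaro means probabilities from some index on. Since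
  push-forwards preserve the total mass, a Cesaro mean has the same mass as \<open>\<mu>\<close>, so this passes to
  \<open>\<mu>\<close> (\<open>cesaro_prob_space\<close>).\<close>

context
  fixes f :: "'a::euclidean_space measure \<Rightarrow> 'a" and \<mu> :: "'a measure measure" and n :: nat
  assumes f: "point_map f"
    and sets_\<mu>: "sets \<mu> = sets (borel_of vague_topology0)"
    and cesaro: "prob_space (point_map_cesaro f \<mu> n)"
begin

lemma measurable_power: "point_shift f ^^ i \<in> \<mu> \<rightarrow>\<^sub>M borel_of vague_topology0"
  using measurable_point_shift_power[OF f] measurable_cong_sets[OF sets_\<mu> refl] by blast

lemma cesaro_prob_space: "prob_space \<mu>" "n > 0"
proof -
  let ?N = "borel_of vague_topology0 :: 'a measure measure"
  have "emeasure (point_map_prob f \<mu> i) (space ?N) = emeasure \<mu> (space \<mu>)" for i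
    unfolding point_map_prob_def
    using measurable_space[OF measurable_power[of i]]
    by (subst emeasure_distr[OF measurable_power]) (auto intro!: arg_cong[where f = "emeasure \<mu>"])
  moreover have "space (point_map_cesaro f \<mu> n) = space ?N"
    by (rule sets_eq_imp_space_eq[OF sets_cesaro])
  ultimately have 1: "1 = of_nat n * emeasure \<mu> (space \<mu>) / of_nat n"
    using emeasure_cesaro[OF cesaro, of "space ?N"] prob_space.emeasure_space_1[OF cesaro] by simp
  then show "n > 0"
    by (cases n) auto
  with 1 have "emeasure \<mu> (space \<mu>) = 1"
    by (metis ennreal_mult_divide_eq mult.commute of_nat_eq_0_iff ennreal_of_nat_neq_top less_irrefl)
  then show "prob_space \<mu>" by (rule prob_spaceI)
qed

lemma prob_space_point_map_prob: "prob_space (point_map_prob f \<mu> i)"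
  unfolding point_map_prob_def
  by (rule prob_space.prob_space_distr[OF cesaro_prob_space(1) measurable_power])

text \<open>The Cesaro mean is the law obtained by choosing \<open>i < n\<close> uniformly and then sampling from the
  \<open>i\<close>-th image of \<open>\<mu>\<close>. In this form integration against it is an instance of iterated integration.\<close>

lemma cesaro_eq_bind:
  "point_map_cesaro f \<mu> n = measure_pmf (pmf_of_set {..<n}) \<bind> point_map_prob f \<mu>"
  and measurable_point_map_prob:
  "point_map_prob f \<mu> \<in> measure_pmf (pmf_of_set {..<n}) \<rightarrow>\<^sub>M subprob_algebra (borel_of vague_topology0)"
proof -
  let ?N = "borel_of vague_topology0 :: 'a measure measure"
  show meas: "point_map_prob f \<mu> \<in> measure_pmf (pmf_of_set {..<n}) \<rightarrow>\<^sub>M subprob_algebra ?N"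
    using prob_space_imp_subprob_space[OF prob_space_point_map_prob]
    by (auto simp: space_subprob_algebra point_map_prob_def)
  show "point_map_cesaro f \<mu> n = measure_pmf (pmf_of_set {..<n}) \<bind> point_map_prob f \<mu>"
  proof (rule measure_eqI)
    show "sets (point_map_cesaro f \<mu> n) = sets (measure_pmf (pmf_of_set {..<n}) \<bind> point_map_prob f \<mu>)"
      unfolding sets_cesaro by (rule sets_bind[symmetric]) (auto simp: point_map_prob_def)
    show "emeasure (point_map_cesaro f \<mu> n) A
        = emeasure (measure_pmf (pmf_of_set {..<n}) \<bind> point_map_prob f \<mu>) A"
      if "A \<in> sets (point_map_cesaro f \<mu> n)" for A
      using that cesaro_prob_space(2) unfolding sets_cesaro
      by (simp add: emeasure_cesaro[OF cesaro] emeasure_bind[OF _ meas] nn_integral_pmf_of_set lessThan_empty_iff)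
  qed
qed

lemma integral_cesaro:
  fixes h :: "'a measure \<Rightarrow> real"
  assumes h: "h \<in> borel_measurable (borel_of vague_topology0)"
    and C: "\<And>\<phi>. \<phi> \<in> space (borel_of vague_topology0) \<Longrightarrow> \<bar>h \<phi>\<bar> \<le> C"
  shows "(\<integral>\<phi>. h \<phi> \<partial>point_map_cesaro f \<mu> n)
    = (\<Sum>i<n. \<integral>\<phi>. h ((point_shift f ^^ i) \<phi>) \<partial>\<mu>) / real n"
proof -
  have "(\<integral>\<phi>. h \<phi> \<partial>point_map_cesaro f \<mu> n)
      = (\<integral>i. (\<integral>\<phi>. h \<phi> \<partial>point_map_prob f \<mu> i) \<partial>measure_pmf (pmf_of_set {..<n}))"
    unfolding cesaro_eq_bind
    by (rule integral_bind[OF h C measurable_point_map_prob, where B' = 1])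
      (auto simp: prob_space.emeasure_space_1[OF prob_space_point_map_prob]
        intro: measure_pmf.finite_measure_axioms)
  also have "\<dots> = (\<Sum>i<n. \<integral>\<phi>. h \<phi> \<partial>point_map_prob f \<mu> i) / real n"
    using cesaro_prob_space(2) by (simp add: integral_pmf_of_set lessThan_empty_iff)
  also have "\<dots> = (\<Sum>i<n. \<integral>\<phi>. h ((point_shift f ^^ i) \<phi>) \<partial>\<mu>) / real n"
    unfolding point_map_prob_def by (simp add: integral_distr[OF measurable_power h])
  finally show ?thesis .
qed

text \<open>Pushing forward moves each summand to the next one, so the difference of the two averages
  telescopes to \<open>(a\<^sub>n - a\<^sub>0) / n\<close>, where \<open>a\<^sub>i\<close> is the integral of \<open>h\<close> against the \<open>i\<close>-th image of \<open>\<mu>\<close>.\<close>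

lemma integral_point_shift_push_cesaro:
  fixes h :: "'a measure \<Rightarrow> real"
  assumes h: "h \<in> borel_measurable (borel_of vague_topology0)"
    and C: "\<And>\<phi>. \<phi> \<in> space (borel_of vague_topology0) \<Longrightarrow> \<bar>h \<phi>\<bar> \<le> C"
  shows "\<bar>(\<integral>\<phi>. h \<phi> \<partial>point_shift_push f (point_map_cesaro f \<mu> n))
    - (\<integral>\<phi>. h \<phi> \<partial>point_map_cesaro f \<mu> n)\<bar> \<le> 2 * C / real n"
proof -
  let ?N = "borel_of vague_topology0 :: 'a measure measure"
  define a where "a i = (\<integral>\<phi>. h ((point_shift f ^^ i) \<phi>) \<partial>\<mu>)" for i
  note shift = measurable_point_shift[OF f]
  have "(\<integral>\<phi>. h \<phi> \<partial>point_shift_push f (point_map_cesaro f \<mu> n))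
      = (\<integral>\<phi>. h (point_shift f \<phi>) \<partial>point_map_cesaro f \<mu> n)"
    unfolding point_shift_push_def
    using shift measurable_cong_sets[OF sets_cesaro refl] h by (intro integral_distr) blast+
  also have "\<dots> = (\<Sum>i<n. a (Suc i)) / real n"
    using integral_cesaro[OF measurable_compose[OF shift h] C[OF measurable_space[OF shift]]]
    by (simp add: a_def)
  finally have "(\<integral>\<phi>. h \<phi> \<partial>point_shift_push f (point_map_cesaro f \<mu> n))
      - (\<integral>\<phi>. h \<phi> \<partial>point_map_cesaro f \<mu> n) = (\<Sum>i<n. a (Suc i) - a i) / real n"
    using integral_cesaro[OF h C] by (simp add: a_def sum_subtractf diff_divide_distrib)
  also have "\<dots> = (a n - a 0) / real n"
    by (simp add: sum_lessThan_telescope)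
  finally have diff: "(\<integral>\<phi>. h \<phi> \<partial>point_shift_push f (point_map_cesaro f \<mu> n))
      - (\<integral>\<phi>. h \<phi> \<partial>point_map_cesaro f \<mu> n) = (a n - a 0) / real n" .
  have "\<bar>a i\<bar> \<le> C" for i
  proof -
    interpret prob_space \<mu> by (rule cesaro_prob_space)
    have bound: "AE \<phi> in \<mu>. \<bar>h ((point_shift f ^^ i) \<phi>)\<bar> \<le> C"
      using C measurable_space[OF measurable_power] by auto
    have "integrable \<mu> (\<lambda>\<phi>. h ((point_shift f ^^ i) \<phi>))"
      by (rule integrable_const_bound[where B = C])
        (use bound measurable_compose[OF measurable_power h] in auto)
    then have "(\<integral>\<phi>. \<bar>h ((point_shift f ^^ i) \<phi>)\<bar> \<partial>\<mu>) \<le> C"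
      using bound by (intro integral_le_const) auto
    then show ?thesis
      unfolding a_def by (rule order_trans[OF integral_abs_bound])
  qed
  from this[of 0] this[of n] have "\<bar>a n - a 0\<bar> \<le> 2 * C"
    by linarith
  then show ?thesis
    unfolding diff by (simp add: divide_right_mono)
qed

end

section \<open>Invariance of the limit\<close>

lemma weak_topology_tendsto_integral:
  assumes lim: "limitin (weak_topology X) \<mu> P F"
    and h: "continuous_map X euclideanreal h" "bounded (h ` topspace X)"
  shows "((\<lambda>i. \<integral>x. h x \<partial>\<mu> i) \<longlongrightarrow> (\<integral>x. h x \<partial>P)) F"
proof (rule topological_tendstoI)
  fix S :: "real set" assume S: "open S" "(\<integral>x. h x \<partial>P) \<in> S"
  let ?U = "{\<mu>. prob_space \<mu> \<and> sets \<mu> = sets (borel_of X)} \<inter> (\<lambda>\<mu>. \<integral>x. h x \<partial>\<mu>) -` S"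
  have "openin (weak_topology X) ?U"
    unfolding weak_topology_def by (rule openin_initial_topology) (use h S(1) in auto)
  moreover have "P \<in> ?U"
    using lim S(2) by (simp add: limitin_def topspace_weak_topology)
  ultimately have "\<forall>\<^sub>F i in F. \<mu> i \<in> ?U"
    using lim unfolding limitin_def by blast
  then show "\<forall>\<^sub>F i in F. (\<integral>x. h x \<partial>\<mu> i) \<in> S"
    by (rule eventually_mono) simp
qed

lemma topcontinuous_at_limitin:
  assumes lim: "limitin X x l F" and cont: "topcontinuous_at X Y g l"
  shows "limitin Y (\<lambda>i. g (x i)) (g l) F"
  unfolding limitin_def
proof (intro conjI allI impI)
  show "g l \<in> topspace Y"
    using cont by (auto simp: topcontinuous_at_def)
  fix V assume V: "openin Y V \<and> g l \<in> V"
  have "\<exists>U. openin X U \<and> l \<in> U \<and> (\<forall>y\<in>U. g y \<in> V)"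
    using cont V by (simp add: topcontinuous_at_def)
  then obtain U where U: "openin X U" "l \<in> U" "\<forall>y\<in>U. g y \<in> V"
    by (elim exE conjE)
  have "\<forall>\<^sub>F i in F. x i \<in> U"
    using lim U(1,2) by (simp add: limitin_def)
  then show "\<forall>\<^sub>F i in F. g (x i) \<in> V"
    by (rule eventually_mono) (use U(3) in simp)
qed

theorem theorem2p19:
  fixes f :: "'a::euclidean_space measure \<Rightarrow> 'a"
    and M :: "'w measure" and \<theta> :: "'a \<Rightarrow> 'w \<Rightarrow> 'w" and \<Phi> :: "'w \<Rightarrow> 'a measure"
    and B :: "'a set"
    and P0 P :: "'a measure measure" and r :: "nat \<Rightarrow> nat"
  assumes "point_map f"
    and "stationary_point_process M \<theta> \<Phi>"
    and "0 < intensity M \<Phi>" and "intensity M \<Phi> < \<infinity>"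
    and "B \<in> sets borel" and "0 < emeasure lborel B" and "emeasure lborel B < \<infinity>"
    and "P0 = palm_distribution M \<theta> \<Phi> B"
    and "strict_mono r" and "\<forall>i. 1 \<le> r i"
    and "limitin (weak_topology vague_topology0) (\<lambda>i. point_map_cesaro f P0 (r i)) P sequentially"
    and "topcontinuous_at (weak_topology vague_topology0) (weak_topology vague_topology0)
           (point_shift_push f) P"
  shows "point_shift_push f P = P"
proof -
  let ?W = "weak_topology vague_topology0 :: 'a measure measure topology"
  let ?\<mu> = "\<lambda>i. point_map_cesaro f P0 (r i)"
  note f = assms(1) and lim = assms(11) and cont = assms(12)
  have sets: "sets P0 = sets (borel_of vague_topology0)"
    unfolding assms(8) by (rule sets_palm_distribution)
  have P: "P \<in> topspace ?W" "point_shift_push f P \<in> topspace ?W"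
    using cont unfolding topcontinuous_at_def by blast+
  have lim_push: "limitin ?W (\<lambda>i. point_shift_push f (?\<mu> i)) (point_shift_push f P) sequentially"
    by (rule topcontinuous_at_limitin[OF lim cont])
  have "\<forall>\<^sub>F i in sequentially. ?\<mu> i \<in> topspace ?W"
    using lim unfolding limitin_def by blast
  then have prob: "\<forall>\<^sub>F i in sequentially. prob_space (?\<mu> i)"
    by (rule eventually_mono) (simp add: topspace_weak_topology)
  show ?thesis
  proof (rule prob_measure_eqI_vague0)
    fix h :: "'a measure \<Rightarrow> real"
    assume h: "continuous_map vague_topology0 euclideanreal h"
      "bounded (h ` topspace vague_topology0)"
    obtain C where C: "\<And>\<phi>. \<phi> \<in> topspace vague_topology0 \<Longrightarrow> \<bar>h \<phi>\<bar> \<le> C"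
      using h(2) unfolding bounded_iff by auto
    let ?d = "\<lambda>i. (\<integral>\<phi>. h \<phi> \<partial>point_shift_push f (?\<mu> i)) - (\<integral>\<phi>. h \<phi> \<partial>?\<mu> i)"
    have "\<forall>\<^sub>F i in sequentially. norm (?d i) \<le> 2 * C / real (r i)"
      using prob
    proof (rule eventually_mono)
      show "norm (?d i) \<le> 2 * C / real (r i)" if "prob_space (?\<mu> i)" for i
        using integral_point_shift_push_cesaro[OF f sets that borel_measurable_continuous_map[OF h(1)], of C] C
        by (simp add: space_borel_of)
    qed
    moreover have "(\<lambda>i. 2 * C / real (r i)) \<longlonglongrightarrow> 0"
      using assms(9) by (intro tendsto_divide_0[OF tendsto_const]
          filterlim_compose[OF filterlim_at_top_imp_at_infinity[OF filterlim_real_sequentially]]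
          filterlim_subseq)
    ultimately have "?d \<longlonglongrightarrow> 0"
      by (rule Lim_null_comparison)
    moreover have "?d \<longlonglongrightarrow> (\<integral>\<phi>. h \<phi> \<partial>point_shift_push f P) - (\<integral>\<phi>. h \<phi> \<partial>P)"
      by (intro tendsto_diff weak_topology_tendsto_integral[OF lim_push h]
          weak_topology_tendsto_integral[OF lim h])
    ultimately have "(\<integral>\<phi>. h \<phi> \<partial>point_shift_push f P) - (\<integral>\<phi>. h \<phi> \<partial>P) = 0"
      using LIMSEQ_unique by blast
    then show "(\<integral>\<phi>. h \<phi> \<partial>point_shift_push f P) = (\<integral>\<phi>. h \<phi> \<partial>P)"
      by simp
  qed (use P in \<open>simp_all add: topspace_weak_topology\<close>)
qed

end
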